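(* Let $G$ be a finite simple connected graph and $Y$ a nonempty full subgraph of $G$. Write $$L(G)=\begin{bmatrix} A & B\\ B^{T} & D\end{bmatrix},$$ where the first block corresponds to $V(G)\setminus V(Y)$ and the second to $V(Y)$. Then $${\det}'(L(G)) = \frac{|V(G)|}{|V(Y)|}\,\det(A)\,{\det}'\big(\mathrm{DN}(G,Y)\big).$$
   Context: For a square matrix $M$, the pseudo-determinant ${\det}'(M)$ is the product of the non-zero eigenvalues of $M$ (with multiplicity; an empty product is $1$, and the determinant of an empty matrix is $1$). A subgraph $Y$ of $G$ is full if $u,v\in V(Y)$ and $\{u,v\}\in E(G)$ imply $\{u,v\}\in E(Y)$. $L(G)$ is the graph Laplacian: $L(G)(u,u)$ is the degree of $u$, $L(G)(u,v)=-1$ if $\{u,v\}\in E(G)$, and $0$ otherwise. Dirichlet-to-Neumann map: with the block form in the claim, $A$ is invertible and $\mathrm{DN}(G,Y)=D-B^TA^{-1}B$, a matrix indexed by $V(Y)$. *)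

theory Defs
  imports
    Graph_Theory.Digraph_Component
    Jordan_Normal_Form.Gauss_Jordan_Elimination
    Jordan_Normal_Form.Spectral_Radius
begin

text \<open>
  Finite simple graphs are the locale \<^locale>\<open>graph\<close>: finite symmetric digraphs without loops
  or parallel arcs, an undirected edge being a pair of opposite arcs. Hence the degree
  of a vertex is its out-degree. Full subgraphs are
  the induced ones (\<^const>\<open>induced_subgraph\<close>).
\<close>

definition laplacian :: "('a, 'b) pre_digraph \<Rightarrow> 'a \<Rightarrow> 'a \<Rightarrow> real" where
  "laplacian G u v =
    (if u = v then real (out_degree G u) else if u \<rightarrow>\<^bsub>G\<^esub> v then -1 else 0)"

text \<open>Rows and columns are indexed by positions in an enumeration \<open>vs\<close> of the vertices.\<close>

definition laplacian_mat :: "('a, 'b) pre_digraph \<Rightarrow> 'a list \<Rightarrow> real mat" where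
  "laplacian_mat G vs = mat (length vs) (length vs) (\<lambda>(i, j). laplacian G (vs ! i) (vs ! j))"

text \<open>
  Here \<open>ws\<close> enumerates the vertices outside the subgraph and \<open>ys\<close> those of the subgraph.
  The value is unspecified unless the block \<open>A\<close> is invertible; this is the case if
  the graph is connected and \<open>ys\<close> is nonempty. The block \<open>A\<close> may be empty.
\<close>

definition dirichlet_to_neumann :: "('a, 'b) pre_digraph \<Rightarrow> 'a list \<Rightarrow> 'a list \<Rightarrow> real mat" where
  "dirichlet_to_neumann G ws ys =
    (case split_block (laplacian_mat G (ws @ ys)) (length ws) (length ws) of
      (A, B, _, D) \<Rightarrow> D - transpose_mat B * the (mat_inverse A) * B)"

text \<open>
  Eigenvalues are taken in the complex numbers and counted with algebraic multiplicity,
  i.e. their order as a root of the characteristic polynomial.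
\<close>

definition pseudo_det :: "complex mat \<Rightarrow> complex" where
  "pseudo_det M = (\<Prod>x \<in> spectrum M - {0}. x ^ order x (char_poly M))"

end

theory Submission
  imports Defs
begin

text \<open>
  For an \<open>n \<times> n\<close> matrix \<open>M\<close> let \<open>e(M)\<close> be the sum of its principal minors of size
  \<open>n - 1\<close>, which is also the elementary symmetric function of degree \<open>n - 1\<close> in the
  eigenvalues. If \<open>0\<close> is a simple eigenvalue, all products in \<open>e(M)\<close> but one contain it, so that
  \<open>e(M)\<close> is the pseudo-determinant (\<open>pseudo_det_eq_principal_cofactor_sum\<close>). It is therefore enough
  to show, with \<open>k\<close> vertices outside \<open>Y\<close>, \<open>m\<close> vertices in \<open>Y\<close> and \<open>S = D - C A\<^sup>-\<^sup>1 B\<close> where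
  \<open>C = B\<^sup>T\<close>, that \<open>m e(L) = (k + m) det A e(S)\<close>, and that \<open>e(L) \<noteq> 0\<close>.

  The number \<open>e(M)\<close> can be read off from a determinant: if \<open>M r = 0\<close> or \<open>v M = 0\<close> for a column
  \<open>r\<close> and a row \<open>v\<close> with \<open>v r \<noteq> 0\<close>, then \<open>det (M + r v) = (v r) e(M)\<close>
  (\<open>det_rank_one_update_right_kernel\<close>, \<open>det_rank_one_update_left_kernel\<close>). Write \<open>1\<close> for a
  vector of ones and add \<open>1\<close> to all entries of \<open>L\<close> in the columns of \<open>Y\<close>. This is the update
  \<open>L + 1 v\<close> where \<open>v\<close> is the indicator row of \<open>Y\<close>; since \<open>L 1 = 0\<close>, its determinant is
  \<open>m e(L)\<close>. The block \<open>A\<close> is left alone, and the Schur complement \<open>S\<close> becomes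
  \<open>S + r 1\<^sup>T\<close> with \<open>r = 1 - C A\<^sup>-\<^sup>1 1\<close>. As the columns of \<open>L\<close> sum to zero,
  \<open>1\<^sup>T C A\<^sup>-\<^sup>1 = - 1\<^sup>T\<close>, so that \<open>1\<^sup>T S = 0\<close> and \<open>1\<^sup>T r = m + k\<close>; hence the same determinant
  is \<open>det A (k + m) e(S)\<close> (\<open>principal_cofactor_sum_Schur_complement\<close>).

  Connectedness enters through the quadratic form
  \<open>2 \<langle>f, L f\<rangle> = \<Sum> (f u - f v)\<^sup>2\<close>, the sum running over all arcs: it vanishes only on constants.
  This makes \<open>A\<close> invertible, as a vector in its kernel extends by zero to a null vector of the form,
  and it makes \<open>L + 1 1\<^sup>T\<close> invertible, whence \<open>e(L) \<noteq> 0\<close>.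
\<close>

section \<open>Determinants of block matrices and rank-one updates\<close>

abbreviation ones_mat :: "nat \<Rightarrow> nat \<Rightarrow> 'a :: one mat" where
  "ones_mat m n \<equiv> mat m n (\<lambda>_. 1)"

lemma det_four_block_mat_Schur:
  fixes A :: "'a :: idom mat"
  assumes A: "A \<in> carrier_mat k k" and B: "B \<in> carrier_mat k m"
    and C: "C \<in> carrier_mat m k" and D: "D \<in> carrier_mat m m"
    and A': "A' \<in> carrier_mat k k" and inv: "A * A' = 1\<^sub>m k"
  shows "det (four_block_mat A B C D) = det A * det (D - C * A' * B)"
proof -
  let ?S = "D - C * A' * B"
  have CA'B: "C * A' * B \<in> carrier_mat m m" using A' B C by simp
  have S: "?S \<in> carrier_mat m m" using CA'B by (rule minus_carrier_mat)
  have "A * (A' * B) = B"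
    using A A' B inv by (simp flip: assoc_mult_mat)
  moreover have "C * (A' * B) + ?S = D"
    using A' B C D CA'B by (intro eq_matI) (auto simp flip: assoc_mult_mat)
  \<comment> \<open>Block Gaussian elimination with pivot \<open>A\<close>: both factors are block triangular.\<close>
  ultimately have "four_block_mat A B C D =
      four_block_mat A (0\<^sub>m k m) C (1\<^sub>m m) * four_block_mat (1\<^sub>m k) (A' * B) (0\<^sub>m m k) ?S"
    using A A' B C D S
    by (subst mult_four_block_mat[of _ k k _ m _ m _ _ k _ m]) auto
  moreover have "det (four_block_mat A (0\<^sub>m k m) C (1\<^sub>m m)) = det A"
    using A C by (subst det_four_block_mat_upper_right_zero[of _ k _ m]) auto
  moreover have "det (four_block_mat (1\<^sub>m k) (A' * B) (0\<^sub>m m k) ?S) = det ?S"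
    using A' B S by (subst det_four_block_mat_lower_left_zero[of _ k _ m]) auto
  ultimately show ?thesis
    using A A' B C S
    by (simp add: det_mult[of _ "k + m"] four_block_carrier_mat)
qed

text \<open>
  Both sides are the determinant of the bordered matrix with blocks \<open>1\<close>, \<open>- r\<close>, \<open>v\<close>, \<open>1\<close>,
  computed by eliminating either of the two diagonal blocks.
\<close>

lemma det_one_plus_rank_one:
  fixes r v :: "'a :: idom mat"
  assumes r: "r \<in> carrier_mat n 1" and v: "v \<in> carrier_mat 1 n"
  shows "det (1\<^sub>m n + r * v) = 1 + (v * r) $$ (0, 0)"
proof -
  let ?P = "four_block_mat (1\<^sub>m n) (- r) v (1\<^sub>m 1)"
  let ?R = "four_block_mat (1\<^sub>m n) (0\<^sub>m n 1) (- v) (1\<^sub>m 1)"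
  have rv: "r * v \<in> carrier_mat n n" and vr: "v * r \<in> carrier_mat 1 1"
    using r v by auto
  have "?P * ?R = four_block_mat (1\<^sub>m n + r * v) (- r) (0\<^sub>m 1 n) (1\<^sub>m 1)"
    using r v rv by (subst mult_four_block_mat[of _ n n _ 1 _ 1 _ _ n _ 1]) auto
  moreover have "det ?R = 1"
    using v by (subst det_four_block_mat_upper_right_zero[of _ n _ 1]) auto
  moreover have "det (four_block_mat (1\<^sub>m n + r * v) (- r) (0\<^sub>m 1 n) (1\<^sub>m 1)) = det (1\<^sub>m n + r * v)"
    using r rv by (subst det_four_block_mat_lower_left_zero[of _ n _ 1]) auto
  ultimately have "det (1\<^sub>m n + r * v) = det ?P"
    using r v by (metis det_mult four_block_carrier_mat mult.right_neutral one_carrier_mat)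
  also have "\<dots> = det (1\<^sub>m 1 - v * 1\<^sub>m n * (- r))"
    using r v by (subst det_four_block_mat_Schur[of _ n _ 1 _ _ "1\<^sub>m n"]) auto
  also have "\<dots> = 1 + (v * r) $$ (0, 0)"
    using r v vr by (subst det_single) auto
  finally show ?thesis .
qed

section \<open>The sum of the cofactors on the diagonal\<close>

text \<open>
  Taking the coefficient of the characteristic polynomial as the definition avoids minors;
  up to the sign, the coefficient of \<open>x\<close> in \<open>det (x - M)\<close> is the sum of the principal minors of
  size \<open>n - 1\<close>. On the empty matrix the value is \<open>0\<close>.
\<close>

definition principal_cofactor_sum :: "'a :: comm_ring_1 mat \<Rightarrow> 'a" where
  "principal_cofactor_sum M = (-1) ^ (dim_row M - 1) * coeff (char_poly M) 1"

lemma poly_char_poly: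
  fixes M :: "'a :: field mat"
  assumes M: "M \<in> carrier_mat n n"
  shows "poly (char_poly M) x = det (x \<cdot>\<^sub>m 1\<^sub>m n - M)"
proof -
  have "- char_matrix M x = x \<cdot>\<^sub>m 1\<^sub>m n - M"
    using M by (intro eq_matI) (auto simp: char_matrix_def)
  then show ?thesis
    by (simp add: char_poly_matrix[OF M])
qed

lemma coeff_char_poly_0:
  fixes M :: "'a :: field mat"
  assumes M: "M \<in> carrier_mat n n"
  shows "coeff (char_poly M) 0 = (-1) ^ n * det M"
proof -
  have "0 \<cdot>\<^sub>m 1\<^sub>m n - M = (-1) \<cdot>\<^sub>m M"
    using M by (intro eq_matI) auto
  then show ?thesis
    using M by (simp add: poly_0_coeff_0[symmetric] poly_char_poly[OF M])
qed

text \<open>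
  Since \<open>M r = 0\<close>, the product \<open>(x - M) (1 - r v / x)\<close> is \<open>x - M - r v\<close> for \<open>x \<noteq> 0\<close>. Taking
  determinants gives the identity at every such \<open>x\<close>.
\<close>

lemma char_poly_rank_one_update:
  fixes M :: "'a :: field_char_0 mat"
  assumes M: "M \<in> carrier_mat n n" and r: "r \<in> carrier_mat n 1" and v: "v \<in> carrier_mat 1 n"
    and Mr: "M * r = 0\<^sub>m n 1"
  shows "[:- ((v * r) $$ (0, 0)), 1:] * char_poly M = [:0, 1:] * char_poly (M + r * v)"
proof -
  define c where "c = (v * r) $$ (0, 0)"
  have rv: "r * v \<in> carrier_mat n n" using r v by simp
  have *: "(x - c) * poly (char_poly M) x = x * poly (char_poly (M + r * v)) x"
    if x: "x \<noteq> 0" for x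
  proof -
    let ?s = "(- (1 / x)) \<cdot>\<^sub>m r"
    have s: "?s \<in> carrier_mat n 1" using r by simp
    have sv: "?s * v = (- (1 / x)) \<cdot>\<^sub>m (r * v)"
      using r v by (rule mult_smult_assoc_mat)
    have Mrv: "M * (r * v) = 0\<^sub>m n n"
      using M r v Mr by (simp flip: assoc_mult_mat[of M n n r 1 v n])
    have cancel: "(x \<cdot>\<^sub>m 1\<^sub>m n - M) + (- W - 0\<^sub>m n n) = x \<cdot>\<^sub>m 1\<^sub>m n - (M + W)"
      if "W \<in> carrier_mat n n" for W
      using M that by (intro eq_matI) auto
    have "(x \<cdot>\<^sub>m 1\<^sub>m n - M) * (1\<^sub>m n + ?s * v) =
        (x \<cdot>\<^sub>m 1\<^sub>m n - M) + (x \<cdot>\<^sub>m 1\<^sub>m n - M) * (?s * v)"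
      using M s v by (subst mult_add_distrib_mat[of _ n n _ n]) auto
    also have "(x \<cdot>\<^sub>m 1\<^sub>m n - M) * (?s * v) =
        (x \<cdot>\<^sub>m 1\<^sub>m n) * (?s * v) - M * (?s * v)"
      using M s v by (subst minus_mult_distrib_mat[of _ n n _ _ n]) auto
    also have "M * (?s * v) = 0\<^sub>m n n"
      unfolding sv using M rv Mrv by (subst mult_smult_distrib[of _ n n _ n]) auto
    also have "(x \<cdot>\<^sub>m 1\<^sub>m n) * (?s * v) = - (r * v)"
      unfolding sv using rv x
      by (subst mult_smult_assoc_mat[of _ n n _ n]) (auto intro!: eq_matI simp del: index_mult_mat)
    also have "(x \<cdot>\<^sub>m 1\<^sub>m n - M) + (- (r * v) - 0\<^sub>m n n) = x \<cdot>\<^sub>m 1\<^sub>m n - (M + r * v)"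
      using rv by (rule cancel)
    finally have "det (x \<cdot>\<^sub>m 1\<^sub>m n - (M + r * v)) = det (x \<cdot>\<^sub>m 1\<^sub>m n - M) * det (1\<^sub>m n + ?s * v)"
      using M s v by (subst det_mult[symmetric, of _ n]) auto
    also have "det (1\<^sub>m n + ?s * v) = 1 - c / x"
      using det_one_plus_rank_one[OF s v] r v by (simp add: c_def)
    finally show ?thesis
      using M rv x by (simp add: poly_char_poly[of _ n] field_simps)
  qed
  \<comment> \<open>An extra factor \<open>x\<close> on both sides makes the values agree at \<open>x = 0\<close> too; it is cancelled afterwards.\<close>
  have "poly ([:0, 1:] * ([:- c, 1:] * char_poly M)) x =
      poly ([:0, 1:] * ([:0, 1:] * char_poly (M + r * v))) x" for x
    using *[of x] by (cases "x = 0") (auto simp: algebra_simps)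
  then have "[:0, 1:] * ([:- c, 1:] * char_poly M) = [:0, 1:] * ([:0, 1:] * char_poly (M + r * v))"
    by (simp add: poly_eq_poly_eq_iff[symmetric] fun_eq_iff)
  then show ?thesis
    unfolding c_def[symmetric] by (subst (asm) mult_cancel_left) auto
qed

text \<open>
  These are the coefficients of \<open>1\<close> and of \<open>x\<close> in the identity above. The condition
  \<open>v r \<noteq> 0\<close> also excludes \<open>r = 0\<close>, for which \<open>M\<close> could be regular.
\<close>

lemma
  fixes M :: "'a :: field_char_0 mat"
  assumes M: "M \<in> carrier_mat n n" and r: "r \<in> carrier_mat n 1" and v: "v \<in> carrier_mat 1 n"
    and Mr: "M * r = 0\<^sub>m n 1" and vr: "(v * r) $$ (0, 0) \<noteq> 0"
  shows coeff_char_poly_0_of_right_kernel: "coeff (char_poly M) 0 = 0"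
    and det_rank_one_update_right_kernel:
      "det (M + r * v) = (v * r) $$ (0, 0) * principal_cofactor_sum M"
proof -
  define c where "c = (v * r) $$ (0, 0)"
  have n: "n > 0"
    using vr r v by (cases n) (auto simp: scalar_prod_def)
  have eq: "[:- c, 1:] * char_poly M = [:0, 1:] * char_poly (M + r * v)"
    unfolding c_def by (rule char_poly_rank_one_update[OF M r v Mr])
  show 0: "coeff (char_poly M) 0 = 0"
    using arg_cong[OF eq, of "\<lambda>p. coeff p 0"] vr by (simp add: c_def)
  have "- c * coeff (char_poly M) 1 = coeff (char_poly (M + r * v)) 0"
    using arg_cong[OF eq, of "\<lambda>p. coeff p 1"] 0 by (simp add: coeff_pCons)
  also have "\<dots> = (-1) ^ n * det (M + r * v)"
    using M r v by (intro coeff_char_poly_0) auto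
  finally have "(-1) ^ n * (- c * coeff (char_poly M) 1) = det (M + r * v)"
    by (simp flip: power_mult_distrib mult.assoc)
  then show "det (M + r * v) = (v * r) $$ (0, 0) * principal_cofactor_sum M"
    using n M by (cases n) (auto simp: principal_cofactor_sum_def c_def mult.left_commute)
qed

lemma
  fixes M :: "'a :: field_char_0 mat"
  assumes M: "M \<in> carrier_mat n n" and r: "r \<in> carrier_mat n 1" and v: "v \<in> carrier_mat 1 n"
    and vM: "v * M = 0\<^sub>m 1 n" and vr: "(v * r) $$ (0, 0) \<noteq> 0"
  shows coeff_char_poly_0_of_left_kernel: "coeff (char_poly M) 0 = 0"
    and det_rank_one_update_left_kernel:
      "det (M + r * v) = (v * r) $$ (0, 0) * principal_cofactor_sum M"
proof -
  note T = transpose_carrier_mat[THEN iffD2]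
  have "transpose_mat M * transpose_mat v = 0\<^sub>m n 1"
    using vM transpose_mult[OF v M] by simp
  moreover have c: "(transpose_mat r * transpose_mat v) $$ (0, 0) = (v * r) $$ (0, 0)"
    using r v transpose_mult[OF v r] by (metis index_transpose_mat(1) mult_carrier_mat carrier_matD less_one)
  ultimately have "coeff (char_poly (transpose_mat M)) 0 = 0"
    "det (transpose_mat M + transpose_mat v * transpose_mat r) =
      (v * r) $$ (0, 0) * principal_cofactor_sum (transpose_mat M)"
    using coeff_char_poly_0_of_right_kernel[OF T[OF M] T[OF v] T[OF r]]
      det_rank_one_update_right_kernel[OF T[OF M] T[OF v] T[OF r]] vr by auto
  moreover have "transpose_mat M + transpose_mat v * transpose_mat r = transpose_mat (M + r * v)"
    using M r v by (simp add: transpose_add[of _ n n] transpose_mult[of _ n 1])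
  ultimately show "coeff (char_poly M) 0 = 0"
    "det (M + r * v) = (v * r) $$ (0, 0) * principal_cofactor_sum M"
    using M r v by (auto simp: principal_cofactor_sum_def det_transpose[of _ n])
qed

section \<open>Pseudo-determinants of matrices of corank one\<close>

text \<open>
  The two conditions say that \<open>0\<close> is a simple root of the characteristic polynomial, which is
  therefore \<open>x q\<close> with \<open>q\<close> the product of \<open>x - z\<close> over the \<open>n - 1\<close> non-zero eigenvalues \<open>z\<close>. The
  coefficient in question is \<open>q 0\<close>, the product of all \<open>- z\<close>.
\<close>

lemma pseudo_det_eq_principal_cofactor_sum:
  assumes M: "M \<in> carrier_mat n n"
    and 0: "coeff (char_poly M) 0 = 0" and nz: "principal_cofactor_sum M \<noteq> 0"
  shows "pseudo_det M = principal_cofactor_sum M"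
proof -
  define p where "p = char_poly M"
  define R where "R = {z. poly p z = 0} - {0}"
  define q where "q = (\<Prod>z\<in>R. [:- z, 1:] ^ order z p)"
  have lead: "lead_coeff p = 1" and deg: "degree p = n"
    using degree_monic_char_poly[OF M] by (auto simp: p_def)
  have p: "p \<noteq> 0" using lead by auto
  have c1: "coeff p 1 \<noteq> 0" using nz by (auto simp: p_def principal_cofactor_sum_def)
  have root: "poly p 0 = 0" using 0 by (simp add: p_def poly_0_coeff_0)
  have fin: "finite R" using poly_roots_finite[OF p] by (simp add: R_def)
  have insert_R: "insert 0 R = {z. poly p z = 0}"
    using root by (auto simp: R_def)
  have ord0: "order 0 p = 1"
  proof (rule order_unique_lemma)
    show "[:- 0, 1:] ^ 1 dvd p" using root by (simp add: poly_eq_0_iff_dvd)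
    show "\<not> [:- 0, 1:] ^ Suc 1 dvd p"
    proof
      assume "[:- 0, 1:] ^ Suc 1 dvd p"
      then obtain s where "p = [:0, 1:] * ([:0, 1:] * s)"
        unfolding dvd_def by (auto simp only: power_Suc power_0 mult.assoc minus_zero mult_1_right power_one_right)
      then show False using c1 by (auto simp: coeff_pCons)
    qed
  qed
  have "p = (\<Prod>z\<in>insert 0 R. [:- z, 1:] ^ order z p)"
    using complex_poly_decompose[of p] lead insert_R by simp
  also have "\<dots> = [:0, 1:] * q"
    using fin ord0 by (subst prod.insert) (auto simp: R_def q_def)
  finally have pq: "p = [:0, 1:] * q" .
  have q: "q \<noteq> 0" using pq p by auto
  have "n = Suc (degree q)"
    using pq q deg by (simp add: degree_mult_eq)
  moreover have "degree q = (\<Sum>z\<in>R. order z p)"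
    unfolding q_def by (subst degree_prod_eq_sum_degree) (auto simp: degree_linear_power)
  ultimately have n: "n - 1 = (\<Sum>z\<in>R. order z p)" by simp
  have "coeff p 1 = poly q 0"
    by (subst pq) (simp add: poly_0_coeff_0)
  also have "\<dots> = (\<Prod>z\<in>R. (- 1) ^ order z p * z ^ order z p)"
    by (simp add: q_def poly_prod flip: power_mult_distrib)
  also have "\<dots> = (-1) ^ (n - 1) * (\<Prod>z\<in>R. z ^ order z p)"
    unfolding n by (simp add: prod.distrib power_sum)
  also have "(\<Prod>z\<in>R. z ^ order z p) = pseudo_det M"
    by (simp add: pseudo_det_def R_def p_def spectrum_root_char_poly[OF M])
  finally show ?thesis
    using M by (simp add: principal_cofactor_sum_def p_def[symmetric] flip: power_mult_distrib mult.assoc)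
qed

lemma pseudo_det_of_real:
  assumes M: "M \<in> carrier_mat n n"
    and "coeff (char_poly M) 0 = 0" and "principal_cofactor_sum M \<noteq> 0"
  shows "pseudo_det (map_mat complex_of_real M) = complex_of_real (principal_cofactor_sum M)"
proof -
  have c: "char_poly (map_mat complex_of_real M) = map_poly of_real (char_poly M)"
    by (rule of_real_hom.char_poly_hom[OF M])
  have "principal_cofactor_sum (map_mat complex_of_real M) = of_real (principal_cofactor_sum M)"
    by (simp add: principal_cofactor_sum_def c coeff_map_poly)
  then show ?thesis
    using assms by (subst pseudo_det_eq_principal_cofactor_sum[of _ n]) (auto simp: c coeff_map_poly)
qed

section \<open>Schur complements of matrices with vanishing row and column sums\<close>

text \<open>
  The matrix obtained from \<open>M\<close> by adding \<open>1\<close> to every entry of the last \<open>m\<close> columns has two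
  descriptions as a rank-one update. As an update of \<open>M\<close> it is governed by the right kernel vector of
  \<open>M\<close>; eliminating \<open>A\<close> turns it into an update of the Schur complement, governed by a left kernel
  vector. The asymmetry is forced: elimination of \<open>A\<close> keeps the row factor \<open>1\<^sup>T\<close> but changes the
  column factor.
\<close>

lemma
  fixes A B C D A' :: "'a :: field_char_0 mat"
  defines "S \<equiv> D - C * A' * B" and "M \<equiv> four_block_mat A B C D"
  assumes A: "A \<in> carrier_mat k k" and B: "B \<in> carrier_mat k m"
    and C: "C \<in> carrier_mat m k" and D: "D \<in> carrier_mat m m"
    and A': "A' \<in> carrier_mat k k" and inv: "A * A' = 1\<^sub>m k" and m: "m > 0"
    and rows: "M * ones_mat (k + m) 1 = 0\<^sub>m (k + m) 1"
    and cols: "ones_mat 1 (k + m) * M = 0\<^sub>m 1 (k + m)"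
  shows coeff_char_poly_0_Schur_complement: "coeff (char_poly S) 0 = 0"
    and principal_cofactor_sum_Schur_complement:
      "of_nat m * principal_cofactor_sum M =
        of_nat (k + m) * det A * principal_cofactor_sum S"
proof -
  define X where "X = C * A'"
  define r where "r = ones_mat m 1 - X * ones_mat k 1"
  define v :: "'a mat" where "v = mat 1 (k + m) (\<lambda>(i, j). if j < k then 0 else 1)"
  have M: "M \<in> carrier_mat (k + m) (k + m)"
    unfolding M_def using A D by (rule four_block_carrier_mat)
  have X: "X \<in> carrier_mat m k" using C A' by (simp add: X_def)
  have S: "S \<in> carrier_mat m m" using X B by (simp add: S_def X_def[symmetric] minus_carrier_mat)
  have r: "r \<in> carrier_mat m 1" using X by (simp add: r_def minus_carrier_mat)
  have v: "v \<in> carrier_mat 1 (k + m)" by (simp add: v_def)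
  have ones[simp]: "ones_mat i j \<in> carrier_mat i j" for i j by simp

  have split: "ones_mat 1 (k + m) =
      four_block_mat (ones_mat 1 k) (ones_mat 1 m) (0\<^sub>m 0 k) (0\<^sub>m 0 m :: 'a mat)"
    by (intro eq_matI) auto
  have blocks: "0\<^sub>m 1 (k + m) = four_block_mat (ones_mat 1 k * A + ones_mat 1 m * C)
      (ones_mat 1 k * B + ones_mat 1 m * D) (0\<^sub>m 0 k) (0\<^sub>m 0 m)"
    unfolding cols[symmetric] M_def split using A B C D
    by (subst mult_four_block_mat[of _ 1 k _ m _ 0 _ _ k _ m]) auto
  have AC: "ones_mat 1 m * C = - (ones_mat 1 k * A)"
  proof (rule eq_matI)
    fix i j assume "i < dim_row (- (ones_mat 1 k * A))" "j < dim_col (- (ones_mat 1 k * A))"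
    then show "(ones_mat 1 m * C) $$ (i, j) = (- (ones_mat 1 k * A)) $$ (i, j)"
      using arg_cong[OF blocks, of "\<lambda>N. N $$ (0, j)"] A C by (simp add: eq_neg_iff_add_eq_0 add.commute)
  qed (use A C in auto)
  have BD: "ones_mat 1 m * D = - (ones_mat 1 k * B)"
  proof (rule eq_matI)
    fix i j assume "i < dim_row (- (ones_mat 1 k * B))" "j < dim_col (- (ones_mat 1 k * B))"
    then show "(ones_mat 1 m * D) $$ (i, j) = (- (ones_mat 1 k * B)) $$ (i, j)"
      using arg_cong[OF blocks, of "\<lambda>N. N $$ (0, k + j)"] A B C D by (simp add: eq_neg_iff_add_eq_0 add.commute)
  qed (use B D in auto)
  have "ones_mat 1 m * X = ones_mat 1 m * C * A'"
    unfolding X_def using C A' by (simp add: assoc_mult_mat[of _ 1 m _ k _ k])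
  also have "\<dots> = - (ones_mat 1 k * A * A')"
    unfolding AC using A A' by simp
  also have "ones_mat 1 k * A * A' = ones_mat 1 k"
    using A A' inv by (simp add: assoc_mult_mat[of _ 1 k _ k _ k])
  finally have oneX: "ones_mat 1 m * X = - ones_mat 1 k" .

  have "ones_mat 1 m * S = ones_mat 1 m * D - ones_mat 1 m * X * B"
    unfolding S_def X_def[symmetric] using B D X
    by (simp add: mult_minus_distrib_mat[of _ 1 m _ m] assoc_mult_mat[of _ 1 m _ k _ m])
  also have "\<dots> = 0\<^sub>m 1 m"
    unfolding oneX BD using B by (intro eq_matI) auto
  finally have oneS: "ones_mat 1 m * S = 0\<^sub>m 1 m" .

  have "ones_mat 1 m * r = ones_mat 1 m * ones_mat m 1 - ones_mat 1 m * X * ones_mat k 1"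
    unfolding r_def using X
    by (simp add: mult_minus_distrib_mat[of _ 1 m _ 1] assoc_mult_mat[of _ 1 m _ k _ 1])
  then have oner: "(ones_mat 1 m * r) $$ (0, 0) = of_nat (k + m)"
    unfolding oneX by (simp add: scalar_prod_def)
  have oner_nz: "(ones_mat 1 m * r) $$ (0, 0) \<noteq> 0"
    unfolding oner of_nat_eq_0_iff using m by simp
  have vone: "(v * ones_mat (k + m) 1) $$ (0, 0) = of_nat m"
  proof -
    have "{0..<k + m} \<inter> - {j. j < k} = {k..<k + m}" by auto
    then show ?thesis by (simp add: v_def scalar_prod_def sum.If_cases)
  qed
  show "coeff (char_poly S) 0 = 0"
    by (rule coeff_char_poly_0_of_left_kernel[OF S r _ oneS]) (use oner_nz in auto)

  have "of_nat m * principal_cofactor_sum M = det (M + ones_mat (k + m) 1 * v)"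
    using det_rank_one_update_right_kernel[OF M _ v rows] vone m by simp
  also have "M + ones_mat (k + m) 1 * v =
      four_block_mat A (B + ones_mat k m) C (D + ones_mat m m)"
    unfolding M_def using A B C D
    by (intro eq_matI) (auto simp: v_def scalar_prod_def)
  also have "det \<dots> = det A * det (D + ones_mat m m - X * (B + ones_mat k m))"
    unfolding X_def using A B C D A' inv by (intro det_four_block_mat_Schur[of _ k _ m]) auto
  also have "D + ones_mat m m - X * (B + ones_mat k m) = S + r * ones_mat 1 m"
  proof -
    have split_ones: "ones_mat i m = ones_mat i 1 * (ones_mat 1 m :: 'a mat)" for i
      by (auto intro!: eq_matI simp: scalar_prod_def)
    have "X * (B + ones_mat k m) = X * B + X * ones_mat k m"
      using X B by (simp add: mult_add_distrib_mat[of _ m k _ m])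
    also have "X * ones_mat k m = X * ones_mat k 1 * ones_mat 1 m"
      unfolding split_ones[of k] using X by (simp add: assoc_mult_mat[of _ m k _ 1 _ m])
    finally have "X * (B + ones_mat k m) = X * B + X * ones_mat k 1 * ones_mat 1 m" .
    moreover have "r * ones_mat 1 m = ones_mat m m - X * ones_mat k 1 * ones_mat 1 m"
      unfolding r_def split_ones[of m] using X
      by (subst minus_mult_distrib_mat[of _ m 1 _ _ m]) auto
    moreover have "D + J - (P + Q) = (D - P) + (J - Q)"
      if "J \<in> carrier_mat m m" "P \<in> carrier_mat m m" "Q \<in> carrier_mat m m" for J P Q
      using D that by (intro eq_matI) auto
    moreover have "X * B \<in> carrier_mat m m" "X * ones_mat k 1 * ones_mat 1 m \<in> carrier_mat m m"
      by (rule mult_carrier_mat[OF X B], rule mult_carrier_mat[OF mult_carrier_mat[OF X ones] ones])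
    ultimately show ?thesis
      by (simp add: S_def X_def[symmetric] del: One_nat_def)
  qed
  also have "det (S + r * ones_mat 1 m) = of_nat (k + m) * principal_cofactor_sum S"
    using det_rank_one_update_left_kernel[OF S r _ oneS] oner_nz unfolding oner by simp
  finally show "of_nat m * principal_cofactor_sum M =
      of_nat (k + m) * det A * principal_cofactor_sum S"
    by (simp add: mult_ac)
qed

section \<open>The Laplacian of a connected graph\<close>

lemma (in graph) laplacian_sym: "laplacian G u v = laplacian G v u"
  using arcs_ends_symmetric[OF sym_arcs] by (auto simp: laplacian_def)

text \<open>
  There are no loops and no parallel arcs, so the degree of \<open>u\<close> counts the neighbours \<open>v\<close> of \<open>u\<close>,
  and each of them contributes \<open>g u\<close> from the diagonal entry.
\<close>

lemma (in graph) laplacian_sum: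
  assumes u: "u \<in> verts G"
  shows "(\<Sum>v\<in>verts G. laplacian G u v * g v) =
    (\<Sum>v\<in>verts G. if u \<rightarrow> v then g u - g v else 0)"
proof -
  have "head G ` out_arcs G u = {v \<in> verts G. u \<rightarrow> v}"
    by (auto simp: out_arcs_def arcs_ends_conv image_iff)
  moreover have "inj_on (head G) (out_arcs G u)"
    by (auto simp: inj_on_def out_arcs_def arc_to_ends_def intro: no_multi_arcs)
  ultimately have "out_degree G u = card {v \<in> verts G. u \<rightarrow> v}"
    by (metis card_image out_degree_def)
  then have deg: "real (out_degree G u) = (\<Sum>v\<in>verts G. if u \<rightarrow> v then 1 else 0)"
    by (simp add: sum.If_cases Int_def)
  have "laplacian G u v * g v =
      (if v = u then real (out_degree G u) * g u else 0) - (if u \<rightarrow> v then g v else 0)" for v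
    using adj_not_same[of u] by (auto simp: laplacian_def)
  then have "(\<Sum>v\<in>verts G. laplacian G u v * g v) =
      real (out_degree G u) * g u - (\<Sum>v\<in>verts G. if u \<rightarrow> v then g v else 0)"
    using u by (simp add: sum_subtractf)
  also have "\<dots> = (\<Sum>v\<in>verts G. if u \<rightarrow> v then g u - g v else 0)"
    unfolding deg sum_distrib_right sum_subtractf[symmetric]
    by (intro sum.cong) auto
  finally show ?thesis .
qed

text \<open>
  Averaging the sum of \<open>f u (f u - f v)\<close> over an arc and its reverse yields the squares; the factor
  \<open>2\<close> appears because every edge is a pair of opposite arcs.
\<close>

lemma (in graph) laplacian_form:
  "2 * (\<Sum>u\<in>verts G. f u * (\<Sum>v\<in>verts G. laplacian G u v * f v)) =
    (\<Sum>u\<in>verts G. \<Sum>v\<in>verts G. if u \<rightarrow> v then (f u - f v)\<^sup>2 else 0)"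
proof -
  let ?s = "\<Sum>u\<in>verts G. \<Sum>v\<in>verts G. if u \<rightarrow> v then f u * (f u - f v) else 0"
  have "(\<Sum>u\<in>verts G. f u * (\<Sum>v\<in>verts G. laplacian G u v * f v)) = ?s"
    by (intro sum.cong refl) (simp add: laplacian_sum sum_distrib_left if_distrib cong: if_cong)
  moreover have "?s = (\<Sum>u\<in>verts G. \<Sum>v\<in>verts G. if u \<rightarrow> v then f v * (f v - f u) else 0)"
    using arcs_ends_symmetric[OF sym_arcs]
    by (subst sum.swap) (intro sum.cong refl if_cong, auto)
  ultimately have "2 * (\<Sum>u\<in>verts G. f u * (\<Sum>v\<in>verts G. laplacian G u v * f v)) =
      ?s + (\<Sum>u\<in>verts G. \<Sum>v\<in>verts G. if u \<rightarrow> v then f v * (f v - f u) else 0)"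
    by simp
  also have "\<dots> = (\<Sum>u\<in>verts G. \<Sum>v\<in>verts G. if u \<rightarrow> v then (f u - f v)\<^sup>2 else 0)"
    unfolding sum.distrib[symmetric]
    by (intro sum.cong refl) (auto simp: power2_eq_square algebra_simps)
  finally show ?thesis .
qed

lemma (in graph) laplacian_form_eq_0_imp_constant:
  assumes conn: "Digraph_Component.connected G"
    and form: "(\<Sum>u\<in>verts G. f u * (\<Sum>v\<in>verts G. laplacian G u v * f v)) = 0"
    and "u \<in> verts G" "v \<in> verts G"
  shows "f u = f v"
proof -
  have "(\<Sum>u\<in>verts G. \<Sum>v\<in>verts G. if u \<rightarrow> v then (f u - f v)\<^sup>2 else 0) = 0"
    using laplacian_form[of f] form by simp
  then have "\<forall>u\<in>verts G. \<forall>v\<in>verts G. (if u \<rightarrow> v then (f u - f v)\<^sup>2 else 0) = 0"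
    by (simp add: sum_nonneg_eq_0_iff sum_nonneg)
  then have adj: "f u = f v" if "u \<rightarrow> v" for u v
    using that adj_in_verts[OF that] by (auto split: if_splits)
  have "u \<rightarrow>\<^sup>*\<^bsub>mk_symmetric G\<^esub> v"
    using conn assms(3,4) by (auto simp: Digraph_Component.connected_def strongly_connected_def)
  then have "u \<rightarrow>\<^sup>* v"
    using reachable_mk_symmetric_eq[OF sym_arcs] by simp
  then show ?thesis
    by induction (auto dest: adj)
qed

context graph
begin

context
  fixes vs :: "'a list" and n :: nat
  assumes vs: "distinct vs" "set vs = verts G" and n: "n = length vs"
begin

lemma laplacian_mat_carrier: "laplacian_mat G vs \<in> carrier_mat n n"
  by (simp add: laplacian_mat_def n)

lemma sum_nth: "(\<Sum>i<n. g (vs ! i)) = (\<Sum>u\<in>verts G. g u)"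
  using sum.reindex_bij_betw[OF bij_betw_nth[OF vs(1) _ vs(2)[symmetric], of "{..<n}"], of g] n
  by simp

lemma laplacian_mat_mult_ones: "laplacian_mat G vs * ones_mat n 1 = 0\<^sub>m n 1"
proof (intro eq_matI)
  fix i j assume "i < dim_row (0\<^sub>m n 1 :: real mat)" "j < dim_col (0\<^sub>m n 1 :: real mat)"
  then have i: "i < n" and j: "j = 0" by auto
  have "(laplacian_mat G vs * ones_mat n 1) $$ (i, j) = (\<Sum>k<n. laplacian G (vs ! i) (vs ! k))"
    using i j n by (simp add: laplacian_mat_def scalar_prod_def atLeast0LessThan)
  also have "\<dots> = (\<Sum>u\<in>verts G. laplacian G (vs ! i) u * 1)"
    by (simp add: sum_nth)
  also have "\<dots> = 0"
    using i n vs nth_mem by (subst laplacian_sum) auto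
  finally show "(laplacian_mat G vs * ones_mat n 1) $$ (i, j) = 0\<^sub>m n 1 $$ (i, j)"
    using i j by simp
qed (auto simp: laplacian_mat_def n)

lemma transpose_laplacian_mat: "transpose_mat (laplacian_mat G vs) = laplacian_mat G vs"
  by (intro eq_matI) (auto simp: laplacian_mat_def laplacian_sym)

lemma ones_mult_laplacian_mat: "ones_mat 1 n * laplacian_mat G vs = 0\<^sub>m 1 n"
proof -
  have "transpose_mat (laplacian_mat G vs * ones_mat n 1) =
      transpose_mat (ones_mat n 1) * laplacian_mat G vs"
    by (subst transpose_mult[of _ n n _ 1])
      (auto simp: transpose_laplacian_mat laplacian_mat_carrier)
  moreover have "transpose_mat (ones_mat n 1) = (ones_mat 1 n :: real mat)"
    by (intro eq_matI) auto
  ultimately show ?thesis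
    by (metis laplacian_mat_mult_ones zero_transpose_mat)
qed

lemma laplacian_mat_form_eq_0_imp_constant:
  assumes conn: "Digraph_Component.connected G" and x: "x \<in> carrier_vec n"
    and form: "x \<bullet> (laplacian_mat G vs *\<^sub>v x) = 0" and i: "i < n" and j: "j < n"
  shows "x $ i = x $ j"
proof -
  \<comment> \<open>the vector \<open>x\<close>, read as a function on the vertices\<close>
  define f where "f u = x $ (THE i. i < n \<and> vs ! i = u)" for u
  have f: "f (vs ! i) = x $ i" if "i < n" for i
    unfolding f_def using that vs(1) n
    by (intro arg_cong[of _ _ "($) x"] the_equality) (auto simp: nth_eq_iff_index_eq)
  have "(laplacian_mat G vs *\<^sub>v x) $ i = (\<Sum>v\<in>verts G. laplacian G (vs ! i) v * f v)"
    if "i < n" for i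
    using that x n
    by (simp add: laplacian_mat_def scalar_prod_def atLeast0LessThan f flip: sum_nth)
  then have "x \<bullet> (laplacian_mat G vs *\<^sub>v x) =
      (\<Sum>u\<in>verts G. f u * (\<Sum>v\<in>verts G. laplacian G u v * f v))"
    using laplacian_mat_carrier
    by (simp add: scalar_prod_def atLeast0LessThan f flip: sum_nth[of "\<lambda>u. f u * _ u"])
  moreover have "vs ! i \<in> verts G" "vs ! j \<in> verts G"
    using i j n nth_mem[of _ vs] unfolding vs(2) by auto
  ultimately show ?thesis
    using laplacian_form_eq_0_imp_constant[OF conn, of f "vs ! i" "vs ! j"] form i j f
    by simp
qed

text \<open>
  Up to the factor \<open>n\<close> this is the determinant of \<open>L + 1 1\<^sup>T\<close>. For \<open>x\<close> in the kernel of that matrix,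
  multiplication by \<open>1\<^sup>T\<close> shows that the entries of \<open>x\<close> sum to \<open>0\<close>; then \<open>L x = 0\<close>, so \<open>x\<close> is
  constant, hence zero. By the matrix-tree theorem the value is \<open>n\<close> times the number of spanning
  trees.
\<close>

lemma principal_cofactor_sum_laplacian_mat_nonzero:
  assumes conn: "Digraph_Component.connected G" and pos: "n > 0"
  shows "principal_cofactor_sum (laplacian_mat G vs) \<noteq> 0"
proof
  let ?L = "laplacian_mat G vs"
  let ?J = "ones_mat n 1 * ones_mat 1 n :: real mat"
  note L = laplacian_mat_carrier
  have Jc: "?J \<in> carrier_mat n n" by (rule mult_carrier_mat[of _ n 1]) auto
  then have LJ: "?L + ?J \<in> carrier_mat n n" by (rule add_carrier_mat)
  assume "principal_cofactor_sum ?L = 0"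
  then have "det (?L + ?J) = 0"
    using det_rank_one_update_right_kernel[OF L _ _ laplacian_mat_mult_ones, of "ones_mat 1 n"] pos
    by (simp add: scalar_prod_def)
  then obtain x where x: "x \<in> carrier_vec n" "x \<noteq> 0\<^sub>v n" and ker: "(?L + ?J) *\<^sub>v x = 0\<^sub>v n"
    using det_0_iff_vec_prod_zero[OF LJ] by blast
  define s where "s = (\<Sum>i<n. x $ i)"
  have J: "?J *\<^sub>v x = vec n (\<lambda>_. s)"
    using x by (intro eq_vecI) (auto simp: scalar_prod_def s_def atLeast0LessThan)
  have one: "ones_mat 1 n *\<^sub>v vec n (\<lambda>_. s) = vec 1 (\<lambda>_. real n * s)"
    by (intro eq_vecI) (auto simp: scalar_prod_def)
  have eq: "?L *\<^sub>v x + vec n (\<lambda>_. s) = 0\<^sub>v n"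
    using ker add_mult_distrib_mat_vec[OF L Jc x(1)] unfolding J by simp
  have "0\<^sub>v 1 = ones_mat 1 n *\<^sub>v (?L *\<^sub>v x + vec n (\<lambda>_. s))"
    unfolding eq by (intro eq_vecI) (auto simp: scalar_prod_def)
  also have "\<dots> = ones_mat 1 n *\<^sub>v (?L *\<^sub>v x) + vec 1 (\<lambda>_. real n * s)"
    unfolding one[symmetric] using L x by (subst mult_add_distrib_mat_vec[of _ 1 n]) auto
  also have "ones_mat 1 n *\<^sub>v (?L *\<^sub>v x) = 0\<^sub>v 1"
    using L x by (subst assoc_mult_mat_vec[symmetric, of _ 1 n _ n])
      (auto simp: ones_mult_laplacian_mat simp del: One_nat_def)
  finally have "real n * s = 0" by (simp add: vec_eq_iff)
  then have s: "s = 0" using pos by simp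
  have "?L *\<^sub>v x = 0\<^sub>v n"
    using eq L x by (auto simp: s vec_eq_iff)
  then have const: "x $ i = x $ 0" if "i < n" for i
    using laplacian_mat_form_eq_0_imp_constant[OF conn x(1), of i 0] that x by auto
  have "s = (\<Sum>i<n. x $ 0)"
    unfolding s_def by (rule sum.cong[OF refl], rule const) simp
  then have "x $ 0 = 0" using s pos by simp
  then have "x = 0\<^sub>v n"
    using x(1) by (intro eq_vecI) (auto dest: const)
  then show False using x(2) by simp
qed

end

text \<open>
  A vector in the kernel of \<open>A\<close>, extended by zero, annihilates the quadratic form of the whole
  Laplacian. It is then constant, and it vanishes on the nonempty second block.
\<close>

lemma det_laplacian_block_nonzero:
  assumes conn: "Digraph_Component.connected G" and vs: "distinct (ws @ ys)" "set (ws @ ys) = verts G"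
    and ys: "ys \<noteq> []"
    and A: "A \<in> carrier_mat (length ws) (length ws)" and B: "B \<in> carrier_mat (length ws) (length ys)"
    and C: "C \<in> carrier_mat (length ys) (length ws)" and D: "D \<in> carrier_mat (length ys) (length ys)"
    and L: "laplacian_mat G (ws @ ys) = four_block_mat A B C D"
  shows "det A \<noteq> 0"
proof
  let ?k = "length ws" and ?m = "length ys"
  assume "det A = 0"
  then obtain x where x: "x \<in> carrier_vec ?k" "x \<noteq> 0\<^sub>v ?k" and Ax: "A *\<^sub>v x = 0\<^sub>v ?k"
    using det_0_iff_vec_prod_zero[OF A] by auto
  let ?y = "x @\<^sub>v 0\<^sub>v ?m"
  have y: "?y \<in> carrier_vec (?k + ?m)" using x by simp
  have "B *\<^sub>v 0\<^sub>v ?m = 0\<^sub>v ?k" "D *\<^sub>v 0\<^sub>v ?m = 0\<^sub>v ?m"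
    using B D by (auto intro!: eq_vecI)
  then have "laplacian_mat G (ws @ ys) *\<^sub>v ?y = 0\<^sub>v ?k @\<^sub>v (C *\<^sub>v x)"
    unfolding L using x A B C D Ax by (subst four_block_mat_mult_vec[of _ ?k ?k _ ?m _ ?m]) auto
  then have "?y \<bullet> (laplacian_mat G (ws @ ys) *\<^sub>v ?y) = 0"
    using x C by (simp add: scalar_prod_append[of _ ?k _ ?m])
  then have "?y $ i = ?y $ ?k" if "i < ?k" for i
    using laplacian_mat_form_eq_0_imp_constant[OF vs refl conn, of ?y i ?k] y that ys by auto
  then have "x = 0\<^sub>v ?k"
    using x ys by (intro eq_vecI) auto
  then show False using x(2) by simp
qed

end

lemma split_block_four_block_mat:
  assumes "A \<in> carrier_mat k k" "B \<in> carrier_mat k m" "C \<in> carrier_mat m k" "D \<in> carrier_mat m m"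
  shows "split_block (four_block_mat A B C D) k k = (A, B, C, D)"
  using assms by (auto simp: split_block_def Let_def intro!: eq_matI)

theorem theorem3p2:
  fixes G Y :: "('a, 'b) pre_digraph"
    and ws ys :: "'a list"
    and A B D :: "real mat"
  assumes "graph G" and "Digraph_Component.connected G"
    and "induced_subgraph Y G" and "verts Y \<noteq> {}"
    and "distinct ws" and "set ws = verts G - verts Y"
    and "distinct ys" and "set ys = verts Y"
    and "A \<in> carrier_mat (length ws) (length ws)"
    and "B \<in> carrier_mat (length ws) (length ys)"
    and "D \<in> carrier_mat (length ys) (length ys)"
    and "laplacian_mat G (ws @ ys) = four_block_mat A B (transpose_mat B) D"
  shows "pseudo_det (map_mat complex_of_real (laplacian_mat G (ws @ ys))) =
    complex_of_real (real (card (verts G)) / real (card (verts Y)) * det A) *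
    pseudo_det (map_mat complex_of_real (dirichlet_to_neumann G ws ys))"
proof -
  interpret graph G by fact
  define k m where "k = length ws" and "m = length ys"
  let ?L = "laplacian_mat G (ws @ ys)"
  note A = assms(9)[folded k_def] and B = assms(10)[folded k_def m_def]
    and D = assms(11)[folded m_def] and block = assms(12)
  have C: "transpose_mat B \<in> carrier_mat m k" using B by simp
  have sub: "verts Y \<subseteq> verts G"
    using \<open>induced_subgraph Y G\<close> by (auto simp: induced_subgraph_def subgraph_def)
  have vs: "distinct (ws @ ys)" "set (ws @ ys) = verts G"
    using assms(5-8) sub by auto
  have len: "k + m = length (ws @ ys)" by (simp add: k_def m_def)
  have ys: "ys \<noteq> []" and m: "m > 0"
    using assms(4,8) by (auto simp: m_def)
  have cardG: "card (verts G) = k + m" and cardY: "card (verts Y) = m"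
    using distinct_card[OF vs(1)] distinct_card[OF assms(7)] assms(8)
    unfolding vs(2) len by (simp_all add: m_def)
  have detA: "det A \<noteq> 0"
    using det_laplacian_block_nonzero[OF assms(2) vs ys] A B C D block
    unfolding k_def m_def by blast
  then obtain A' where A': "mat_inverse A = Some A'"
    using det_non_zero_imp_unit[OF A, where b = "()"] mat_inverse(1)[OF A, where b = "()"]
    by (cases "mat_inverse A") auto
  note inv = mat_inverse(2)[OF A A']
  define S where "S = D - transpose_mat B * A' * B"
  have "dirichlet_to_neumann G ws ys = S"
    using split_block_four_block_mat[OF A B C D] A'
    by (simp add: dirichlet_to_neumann_def block k_def S_def)
  moreover have S: "S \<in> carrier_mat m m"
    using B inv by (auto simp: S_def intro!: minus_carrier_mat)
  have L: "?L \<in> carrier_mat (k + m) (k + m)"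
    by (rule laplacian_mat_carrier[OF vs len])
  have L0: "coeff (char_poly ?L) 0 = 0"
    by (rule coeff_char_poly_0_of_right_kernel[OF L _ _ laplacian_mat_mult_ones[OF vs len],
          of "ones_mat 1 (k + m)"])
      (use m in \<open>auto simp: scalar_prod_def\<close>)
  have Lnz: "principal_cofactor_sum ?L \<noteq> 0"
    using principal_cofactor_sum_laplacian_mat_nonzero[OF vs len assms(2)] m by simp
  have S0: "coeff (char_poly S) 0 = 0"
    and key: "real m * principal_cofactor_sum ?L = real (k + m) * det A * principal_cofactor_sum S"
    unfolding S_def block
    using coeff_char_poly_0_Schur_complement[OF A B C D _ _ m, of A']
      principal_cofactor_sum_Schur_complement[OF A B C D _ _ m, of A']
      inv laplacian_mat_mult_ones[OF vs len] ones_mult_laplacian_mat[OF vs len]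
    unfolding block by blast+
  have Snz: "principal_cofactor_sum S \<noteq> 0"
    using key Lnz m by auto
  have "principal_cofactor_sum ?L = real (k + m) / real m * det A * principal_cofactor_sum S"
    using key m by (simp add: field_simps)
  then show ?thesis
    using pseudo_det_of_real[OF L L0 Lnz] pseudo_det_of_real[OF S S0 Snz] calculation
    by (simp add: cardG cardY)
qed

end
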